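(* Let $q$ be a prime power, let $0\leqslant j\leqslant q-2$ and let $n\geqslant 1$ be an integer with $n\leqslant j+1$. Then the matrix $M(j,n,q)$ is antidiagonal, i.e. its entry $m_{a,b}$ is $0$ whenever $a+b\neq n+1$.
   Context: Let $q$ be a power of a prime $p$. For integers $0\leqslant j\leqslant q-2$ and $n\geqslant 1$, $M(j,n,q)=(m_{a,b})_{1\leqslant a,b\leqslant n}$ is the $n\times n$ matrix over $\mathbb{F}_p$ with entries (binomial coefficients reduced modulo $p$, with $\binom{x}{y}=0$ for integers $0\leqslant x<y$) $$m_{a,b}=-\left[\binom{j+(n-a)(q-1)}{j+(n-b)(q-1)}+(-1)^{j+1}\binom{j+(n-a)(q-1)}{j+(b-1)(q-1)}\right]\ \text{ if } a\neq b,\qquad m_{a,a}=(-1)^{j+2}\binom{j+(n-a)(q-1)}{j+(a-1)(q-1)}.$$ (It is the matrix of coefficients, with the powers of $t$ removed, of the Atkin operator $U_t$ acting on a block of $\Gamma_0(t)$-invariant Drinfeld cusp forms of weight $k=2j+2+(n-1)(q-1)$.) *)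

theory Defs
  imports "Jordan_Normal_Form.Matrix" "Berlekamp_Zassenhaus.Finite_Field"
begin

text \<open>
  The field $\mathbb{F}_p$ is the type \<open>'p mod_ring\<close> with \<open>p = CARD('p)\<close> prime.
  The entries $m_{a,b}$ are indexed by $1 \le a, b \le n$; in this range, and for $q \ge 1$,
  none of the natural-number subtractions below truncates.
\<close>

definition atkin_entry :: "nat \<Rightarrow> nat \<Rightarrow> nat \<Rightarrow> nat \<Rightarrow> nat \<Rightarrow> 'p::prime_card mod_ring" where
  "atkin_entry j n q a b =
     (if a = b
      then (-1) ^ (j + 2) *
             of_nat ((j + (n - a) * (q - 1)) choose (j + (a - 1) * (q - 1)))
      else - (of_nat ((j + (n - a) * (q - 1)) choose (j + (n - b) * (q - 1)))
              + (-1) ^ (j + 1) *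
                of_nat ((j + (n - a) * (q - 1)) choose (j + (b - 1) * (q - 1)))))"

text \<open>Matrices of type \<open>mat\<close> are indexed from 0, hence the shifts by 1.\<close>

definition atkin_matrix :: "nat \<Rightarrow> nat \<Rightarrow> nat \<Rightarrow> 'p::prime_card mod_ring mat" where
  "atkin_matrix j n q = mat n n (\<lambda>(r, c). atkin_entry j n q (r + 1) (c + 1))"

definition antidiagonal_mat :: "'a::zero mat \<Rightarrow> bool" where
  "antidiagonal_mat A \<longleftrightarrow>
     square_mat A \<and>
     (\<forall>a\<in>{1..dim_row A}. \<forall>b\<in>{1..dim_row A}.
        a + b \<noteq> dim_row A + 1 \<longrightarrow> A $$ (a - 1, b - 1) = 0)"

end

theory Submission
  imports Defs
begin

text \<open>
  Since \<open>j + s(q - 1) = sq + (j - s)\<close> has base-\<open>q\<close> digits \<open>s\<close> and \<open>j - s\<close> for \<open>s \<le> j < q\<close>,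
  the Lucas congruence gives \<open>C(j + s(q-1), j + t(q-1)) = C(s, t) C(j - s, j - t)\<close> modulo \<open>p\<close>.
  The first factor vanishes unless \<open>t \<le> s\<close>, the second unless \<open>s \<le> t\<close>. In \<open>m_{a,b}\<close> the pairs
  \<open>(s, t)\<close> are \<open>(n - a, n - b)\<close> for \<open>a \<noteq> b\<close> and \<open>(n - a, b - 1)\<close>, and \<open>n - a = b - 1\<close> exactly
  on the antidiagonal.
\<close>

text \<open>By absorption, \<open>p ^ e\<close> divides \<open>k\<close> times the coefficient; were
  the coefficient prime to \<open>p\<close>, all of \<open>p ^ e\<close> would divide
  \<open>k\<close>.\<close>

lemma prime_dvd_choose_mult_prime_power:
  fixes p e s k :: nat
  assumes "prime p" and "\<not> p ^ e dvd k"
  shows "p dvd (s * p ^ e) choose k"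
proof (rule ccontr)
  assume "\<not> p dvd (s * p ^ e) choose k"
  then have coprime: "coprime (p ^ e) ((s * p ^ e) choose k)"
    using assms(1) by (simp add: prime_imp_coprime)
  have "k > 0"
    using assms(2) by (cases k) auto
  then have "k * ((s * p ^ e) choose k) = s * p ^ e * ((s * p ^ e - 1) choose (k - 1))"
    by (rule times_binomial_minus1_eq)
  then have "p ^ e dvd k * ((s * p ^ e) choose k)"
    by simp
  with coprime have "p ^ e dvd k"
    by (simp add: coprime_dvd_mult_left_iff)
  with assms(2) show False ..
qed

text \<open>Each term of Vandermonde's sum is divisible by \<open>p\<close>: by the previous lemma
  unless \<open>k = i * p ^ e\<close>; then \<open>v < p ^ e\<close> forces
  \<open>i \<le> t\<close>, leaving at least \<open>v > u\<close> elements to choose from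
  \<open>u\<close>.\<close>

lemma prime_dvd_choose_of_last_digit_less:
  fixes p e s t u v :: nat
  assumes "prime p" and "u < v" and "v < p ^ e"
  shows "p dvd (s * p ^ e + u) choose (t * p ^ e + v)"
proof -
  have "p dvd ((s * p ^ e) choose k) * (u choose (t * p ^ e + v - k))"
    if "k \<le> t * p ^ e + v" for k
  proof (cases "p ^ e dvd k")
    case True
    then obtain i where k: "k = i * p ^ e"
      by (metis dvd_def mult.commute)
    have "i \<le> t"
    proof (rule ccontr)
      assume "\<not> i \<le> t"
      then have "Suc t * p ^ e \<le> i * p ^ e"
        by (intro mult_right_mono) auto
      with that k assms(3) show False
        by simp
    qed
    then have "i * p ^ e \<le> t * p ^ e"
      by simp
    then have "u < t * p ^ e + v - k"
      using assms(2) k by linarith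
    then show ?thesis
      by (simp add: binomial_eq_0)
  next
    case False
    then show ?thesis
      using assms(1) by (simp add: prime_dvd_choose_mult_prime_power)
  qed
  then show ?thesis
    unfolding vandermonde[symmetric] by (intro dvd_sum) auto
qed

lemma prime_dvd_choose_add_mult_pred:
  fixes p e j s t :: nat
  assumes "prime p" and "j < p ^ e" and "s \<le> j" and "t \<le> j" and "s \<noteq> t"
  shows "p dvd (j + s * (p ^ e - 1)) choose (j + t * (p ^ e - 1))"
proof (cases "s < t")
  case True
  \<comment> \<open>A positive factor \<open>p ^ e - 1\<close> makes the lower index exceed the
    upper one.\<close>
  have "p ^ e > 1"
    using assms(2) True assms(4) by linarith
  with True show ?thesis
    by (simp add: binomial_eq_0)
next
  case False
  have digits: "j + x * (p ^ e - 1) = x * p ^ e + (j - x)" if "x \<le> j" for x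
  proof -
    have "x \<le> x * p ^ e"
      using assms(2) by (cases "p ^ e") auto
    with that show ?thesis
      by (simp add: diff_mult_distrib2)
  qed
  have "j - s < j - t" "j - t < p ^ e"
    using False assms by auto
  with assms(1) show ?thesis
    unfolding digits[OF assms(3)] digits[OF assms(4)]
    by (rule prime_dvd_choose_of_last_digit_less)
qed

theorem theorem5p2:
  fixes q e j n :: nat
  assumes "e \<ge> 1" and "q = CARD('p::prime_card) ^ e"
    and "j \<le> q - 2"
    and "n \<ge> 1" and "n \<le> j + 1"
  shows "antidiagonal_mat (atkin_matrix j n q :: 'p mod_ring mat)"
proof -
  have p: "prime CARD('p)"
    by (rule prime_card)
  have "q > 0"
    using p assms(2) by (simp add: prime_gt_0_nat)
  then have "j < q"
    using assms(3) by linarith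
  then have vanish: "of_nat ((j + s * (q - 1)) choose (j + t * (q - 1))) = (0 :: 'p mod_ring)"
    if "s \<le> j" "t \<le> j" "s \<noteq> t" for s t
    using prime_dvd_choose_add_mult_pred[OF p _ that] assms(2)
    by (simp add: of_nat_eq_0_iff_char_dvd)
  have "atkin_entry j n q a b = (0 :: 'p mod_ring)"
    if "a \<in> {1..n}" "b \<in> {1..n}" "a + b \<noteq> n + 1" for a b
  proof -
    \<comment> \<open>\<open>n \<le> j + 1\<close> keeps all indices within \<open>j\<close>; for
      \<open>a = b\<close> only the pair \<open>(n - a, b - 1)\<close> occurs.\<close>
    have "n - a \<le> j" "n - b \<le> j" "b - 1 \<le> j" "n - a \<noteq> b - 1" "a \<noteq> b \<Longrightarrow> n - a \<noteq> n - b"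
      using that assms(5) by auto
    then show ?thesis
      unfolding atkin_entry_def by (auto simp: vanish simp del: One_nat_def)
  qed
  then show ?thesis
    unfolding antidiagonal_mat_def atkin_matrix_def by auto
qed

end
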